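(* Consider the two-stage electricity market with a real-time market power mitigation (MPM) policy and price-anticipating participants described in the context, with generators $\mathcal{G}$ (cost coefficients $c_j>0$, estimation errors $\epsilon_j\ge 0$), loads $\mathcal{L}$, and aggregate demand $d>0$. Then a Nash equilibrium does not exist.
   Context: Setting. $\mathcal{G}$ is a finite nonempty set of generators and $\mathcal{L}$ a finite nonempty set of loads, $L=|\mathcal{L}|$. Generator $j$ has cost $\frac{c_j}{2}g_j^2$, $c_j>0$, for total output $g_j=g_j^d+g_j^r$ (superscripts $d$, $r$: day-ahead, real-time). Load $l$ has fixed demand $d_l\in\mathbb{R}$, split as $d_l=d_l^d+d_l^r$. Put $d=\sum_l d_l>0$ and $d^d=\sum_l d_l^d$. Strategies. Simultaneously in the day-ahead market, generator $j$ chooses a slope $\theta_j^d\in\mathbb{R}$ and load $l$ chooses a quantity $d_l^d\in\mathbb{R}$ (so $d_l^r=d_l-d_l^d$). Generators do not bid in real time. Real-time stage (MPM policy). The operator estimates the cost coefficient of generator $j$ as $c_j+\epsilon_j$, $\epsilon_j\ge0$, and dispatches $g_j^r=(c_j+\epsilon_j)^{-1}\lambda^r-g_j^d$; with the overall balance $\sum_j(g_j^d+g_j^r)=d$ the real-time price is the constant $\lambda^r=d/\sum_{k\in\mathcal{G}}(c_k+\epsilon_k)^{-1}$. Day-ahead price. Generator $j$ is dispatched $g_j^d=\theta_j^d\lambda^d$, where $\lambda^d$ is determined by all bids through the clearing condition $\sum_j\theta_j^d\lambda^d=d^d$, i.e. $\lambda^d=d^d/\sum_j\theta_j^d$ if $\sum_j\theta_j^d\ne0$.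 If $\sum_j\theta_j^d=0$: when $d^d=0$, the price is set to $\lambda^d=\lambda^r$ (Rule 1); when $d^d\neq0$, the price is set to $\lambda^d=0$ and the day-ahead demand is split evenly across all loads, i.e. each load is allocated $d^d/L$ in the day-ahead stage and the remainder of its demand in real time (Rule 2). Payoffs. With $\omega_j:=\frac{(c_j+\epsilon_j)^{-1}}{\sum_k(c_k+\epsilon_k)^{-1}}$, generator $j$ maximizes $$\pi_j=\theta_j^{d}(\lambda^{d})^2+\lambda^r\left(\omega_j d-\theta_j^{d}\lambda^{d}\right)-\tfrac{c_j}{2}(\omega_j d)^2,$$ and load $l$ minimizes its payment $\rho_l=\lambda^d d_l^d+\lambda^r(d_l-d_l^d)$ (evaluated at its allocation), each anticipating the dependence of $\lambda^d$ on its own bid and knowing all other bids. A Nash equilibrium is a profile $((\theta_j^d)_{j},(d_l^d)_{l})$ with the resulting prices such that no single generator can strictly increase $\pi_j$, and no single load can strictly decrease $\rho_l$, by unilaterally changing its own bid, and the market clears. *)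

theory Defs imports Complex_Main begin

record ('g, 'l) market =
  gens :: "'g set"
  loads :: "'l set"
  cost :: "'g \<Rightarrow> real"
  err :: "'g \<Rightarrow> real"
  demand :: "'l \<Rightarrow> real"

definition total_demand :: "('g, 'l) market \<Rightarrow> real" where
  "total_demand M = (\<Sum>l\<in>loads M. demand M l)"

text \<open>
  The operator's estimate of the cost coefficient of generator \<open>j\<close> is \<open>cost M j + err M j\<close>.
  The real-time price and the final output \<open>share M j * total_demand M\<close> of a generator
  depend on these estimates only, not on the bids.
\<close>

definition rt_price :: "('g, 'l) market \<Rightarrow> real" where
  "rt_price M = total_demand M / (\<Sum>k\<in>gens M. inverse (cost M k + err M k))"

definition share :: "('g, 'l) market \<Rightarrow> 'g \<Rightarrow> real" where
  "share M j = inverse (cost M j + err M j) / (\<Sum>k\<in>gens M. inverse (cost M k + err M k))"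

text \<open>
  A bid profile consists of the slopes \<open>\<theta>\<close> of the generators and the day-ahead quantities \<open>q\<close>
  of the loads; values of \<open>\<theta>\<close> and \<open>q\<close> outside \<open>gens M\<close> and \<open>loads M\<close> are irrelevant.
\<close>

definition total_slope :: "('g, 'l) market \<Rightarrow> ('g \<Rightarrow> real) \<Rightarrow> real" where
  "total_slope M \<theta> = (\<Sum>j\<in>gens M. \<theta> j)"

definition da_demand :: "('g, 'l) market \<Rightarrow> ('l \<Rightarrow> real) \<Rightarrow> real" where
  "da_demand M q = (\<Sum>l\<in>loads M. q l)"

text \<open>
  If the slopes sum to zero but the day-ahead demand does not, no price satisfies the day-ahead
  clearing condition. Then the price is set to \<open>0\<close> and the day-ahead demand is
  split evenly over the loads, whatever their individual bids.
\<close>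

definition no_clearing_price :: "('g, 'l) market \<Rightarrow> ('g \<Rightarrow> real) \<Rightarrow> ('l \<Rightarrow> real) \<Rightarrow> bool" where
  "no_clearing_price M \<theta> q \<longleftrightarrow> total_slope M \<theta> = 0 \<and> da_demand M q \<noteq> 0"

definition da_price :: "('g, 'l) market \<Rightarrow> ('g \<Rightarrow> real) \<Rightarrow> ('l \<Rightarrow> real) \<Rightarrow> real" where
  "da_price M \<theta> q =
    (if total_slope M \<theta> \<noteq> 0 then da_demand M q / total_slope M \<theta>
     else if da_demand M q = 0 then rt_price M
     else 0)"

definition da_alloc :: "('g, 'l) market \<Rightarrow> ('g \<Rightarrow> real) \<Rightarrow> ('l \<Rightarrow> real) \<Rightarrow> 'l \<Rightarrow> real" where
  "da_alloc M \<theta> q l =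
    (if no_clearing_price M \<theta> q then da_demand M q / real (card (loads M)) else q l)"

definition da_dispatch :: "('g, 'l) market \<Rightarrow> ('g \<Rightarrow> real) \<Rightarrow> ('l \<Rightarrow> real) \<Rightarrow> 'g \<Rightarrow> real" where
  "da_dispatch M \<theta> q j = \<theta> j * da_price M \<theta> q"

definition rt_dispatch :: "('g, 'l) market \<Rightarrow> ('g \<Rightarrow> real) \<Rightarrow> ('l \<Rightarrow> real) \<Rightarrow> 'g \<Rightarrow> real" where
  "rt_dispatch M \<theta> q j = inverse (cost M j + err M j) * rt_price M - da_dispatch M \<theta> q j"

definition gen_profit :: "('g, 'l) market \<Rightarrow> ('g \<Rightarrow> real) \<Rightarrow> ('l \<Rightarrow> real) \<Rightarrow> 'g \<Rightarrow> real" where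
  "gen_profit M \<theta> q j =
    \<theta> j * (da_price M \<theta> q)\<^sup>2
    + rt_price M * (share M j * total_demand M - \<theta> j * da_price M \<theta> q)
    - cost M j / 2 * (share M j * total_demand M)\<^sup>2"

definition load_payment :: "('g, 'l) market \<Rightarrow> ('g \<Rightarrow> real) \<Rightarrow> ('l \<Rightarrow> real) \<Rightarrow> 'l \<Rightarrow> real" where
  "load_payment M \<theta> q l =
    da_price M \<theta> q * da_alloc M \<theta> q l + rt_price M * (demand M l - da_alloc M \<theta> q l)"

text \<open>
  Day-ahead balance is required only when some price can achieve it, so profiles to which the
  even-split rule applies are not excluded as equilibria by definition. Requiring
  day-ahead balance there as well would leave fewer candidate equilibria.
\<close>

definition market_clears :: "('g, 'l) market \<Rightarrow> ('g \<Rightarrow> real) \<Rightarrow> ('l \<Rightarrow> real) \<Rightarrow> bool" where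
  "market_clears M \<theta> q \<longleftrightarrow>
    (\<not> no_clearing_price M \<theta> q \<longrightarrow> (\<Sum>j\<in>gens M. da_dispatch M \<theta> q j) = da_demand M q) \<and>
    (\<Sum>j\<in>gens M. da_dispatch M \<theta> q j + rt_dispatch M \<theta> q j) = total_demand M"

definition nash_equilibrium :: "('g, 'l) market \<Rightarrow> ('g \<Rightarrow> real) \<Rightarrow> ('l \<Rightarrow> real) \<Rightarrow> bool" where
  "nash_equilibrium M \<theta> q \<longleftrightarrow>
    (\<forall>j\<in>gens M. \<forall>x. gen_profit M (\<theta>(j := x)) q j \<le> gen_profit M \<theta> q j) \<and>
    (\<forall>l\<in>loads M. \<forall>x. load_payment M \<theta> q l \<le> load_payment M \<theta> (q(l := x)) l) \<and>
    market_clears M \<theta> q"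

end

theory Submission imports Defs begin

text \<open>
  Write \<open>r\<close> for the real-time price, \<open>S\<close> for the total slope, \<open>D\<close> for the day-ahead demand and
  \<open>p\<close> for the day-ahead price; up to a constant the payoff of a generator is \<open>\<theta>\<^sub>j p (p - r)\<close> and
  the payment of a load is \<open>q\<^sub>l (p - r)\<close>.
  If \<open>S \<noteq> 0\<close>, summing the first-order conditions of the loads gives \<open>0 < p < r\<close>, while summing those
  of the \<open>n\<close> generators gives \<open>(n - 1) (p - r) = p\<close>, a contradiction. If \<open>S = 0\<close> and \<open>D = 0\<close>, a load gains
  by a positive bid, which triggers Rule 2. If \<open>S = 0\<close> and \<open>D \<noteq> 0\<close>, some \<open>\<theta>\<^sub>j \<ge> 0\<close>, and that generator
  can raise its slope so as to move the price to \<open>2 r\<close> or \<open>-r\<close>, where \<open>p (p - r) > 0\<close>.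
\<close>

lemma total_slope_upd:
  assumes "finite (gens M)" "j \<in> gens M"
  shows "total_slope M (\<theta>(j := x)) = total_slope M \<theta> - \<theta> j + x"
  unfolding total_slope_def using assms by (simp add: sum.remove)

lemma da_demand_upd:
  assumes "finite (loads M)" "l \<in> loads M"
  shows "da_demand M (q(l := x)) = da_demand M q - q l + x"
  unfolding da_demand_def using assms by (simp add: sum.remove)

lemma gen_profit_eq:
  "gen_profit M \<theta> q j =
    \<theta> j * (da_price M \<theta> q * (da_price M \<theta> q - rt_price M))
    + (rt_price M * (share M j * total_demand M) - cost M j / 2 * (share M j * total_demand M)\<^sup>2)"
  by (simp add: gen_profit_def power2_eq_square algebra_simps)

lemma load_payment_eq:
  "load_payment M \<theta> q l =
    (da_price M \<theta> q - rt_price M) * da_alloc M \<theta> q l + rt_price M * demand M l"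
  by (simp add: load_payment_def algebra_simps)

lemma rt_price_pos:
  assumes "finite (gens M)" "gens M \<noteq> {}"
    and "\<And>j. j \<in> gens M \<Longrightarrow> cost M j > 0" "\<And>j. j \<in> gens M \<Longrightarrow> err M j \<ge> 0"
    and "total_demand M > 0"
  shows "rt_price M > 0"
  unfolding rt_price_def using assms
  by (intro divide_pos_pos sum_pos) (simp_all add: add_pos_nonneg)

text \<open>A load's bid leaves the nonzero total slope unchanged, so Rule 2 never applies and the
  payment is, up to a constant, quadratic in the own bid; its derivative vanishes at a
  minimum.\<close>

lemma load_first_order:
  assumes "finite (loads M)" "l \<in> loads M" and S: "total_slope M \<theta> \<noteq> 0"
    and opt: "\<And>y. load_payment M \<theta> q l \<le> load_payment M \<theta> (q(l := y)) l"
  shows "q l = rt_price M * total_slope M \<theta> - da_demand M q"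
proof -
  define S where "S = total_slope M \<theta>"
  define D where "D = da_demand M q"
  define f where "f y = ((D - q l + y) / S - rt_price M) * y" for y
  have "f (q l) \<le> f y" for y
    using opt[of y] S da_demand_upd[OF assms(1,2)]
    by (simp add: load_payment_eq da_price_def da_alloc_def no_clearing_price_def f_def S_def D_def)
  moreover have "(f has_real_derivative (q l / S + (D / S - rt_price M))) (at (q l))"
    unfolding f_def[abs_def] using S by (auto intro!: derivative_eq_intros simp: S_def)
  ultimately have "q l / S + (D / S - rt_price M) = 0"
    by (intro DERIV_local_min[of f _ "q l" 1]) auto
  then show ?thesis
    using S by (simp add: S_def D_def field_simps)
qed

lemma gen_first_order:
  assumes "finite (gens M)" "j \<in> gens M" and S: "total_slope M \<theta> \<noteq> 0"
    and D: "da_demand M q \<noteq> 0"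
    and opt: "\<And>x. gen_profit M (\<theta>(j := x)) q j \<le> gen_profit M \<theta> q j"
  shows "total_slope M \<theta> * (da_price M \<theta> q - rt_price M)
    = \<theta> j * (2 * da_price M \<theta> q - rt_price M)"
proof -
  define S where "S = total_slope M \<theta>"
  define p where "p = da_price M \<theta> q"
  define r where "r = rt_price M"
  \<comment> \<open>Since \<open>p * S\<close> is the day-ahead demand, the repeated quotient is the
    price after a deviation to \<open>x\<close>.\<close>
  define f where "f x = x * (p * S / (S - \<theta> j + x) * (p * S / (S - \<theta> j + x) - r))" for x
  have S0: "S \<noteq> 0" and pS: "da_demand M q = p * S" and p0: "p \<noteq> 0"
    using S D by (simp_all add: S_def p_def da_price_def)
  \<comment> \<open>Deviations smaller than \<open>\<bar>S\<bar>\<close> keep the new total slope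
    nonzero.\<close>
  have "f x \<le> f (\<theta> j)" if "\<bar>\<theta> j - x\<bar> < \<bar>S\<bar>" for x
  proof -
    have "S - \<theta> j + x \<noteq> 0" using that by linarith
    then show ?thesis
      using opt[of x] S0 pS total_slope_upd[OF assms(1,2)]
      by (simp add: gen_profit_eq da_price_def f_def S_def r_def)
  qed
  moreover have "(f has_real_derivative (p * (p - r) - \<theta> j * (2 * p - r) * p / S)) (at (\<theta> j))"
    unfolding f_def[abs_def] using S0
    by (auto intro!: derivative_eq_intros simp: field_simps power2_eq_square)
  ultimately have "p * (p - r) - \<theta> j * (2 * p - r) * p / S = 0"
    using S0 by (intro DERIV_local_max[of f _ "\<theta> j" "\<bar>S\<bar>"]) auto
  then have "p * (S * (p - r)) = p * (\<theta> j * (2 * p - r))"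
    using S0 by (simp add: field_simps)
  then show ?thesis using p0 by (simp add: S_def p_def r_def)
qed

lemma no_equilibrium_slope_nonzero:
  assumes g: "finite (gens M)" "gens M \<noteq> {}" and l: "finite (loads M)" "loads M \<noteq> {}"
    and r: "rt_price M > 0" and S: "total_slope M \<theta> \<noteq> 0"
  shows "\<not> nash_equilibrium M \<theta> q"
proof
  assume eq: "nash_equilibrium M \<theta> q"
  define S where "S = total_slope M \<theta>"
  define D where "D = da_demand M q"
  define p where "p = da_price M \<theta> q"
  define r where "r = rt_price M"
  define L where "L = real (card (loads M))"
  define n where "n = real (card (gens M))"
  have S0: "S \<noteq> 0" and r0: "r > 0" using S r by (simp_all add: S_def r_def)
  have D_eq: "D = p * S" using S by (simp add: p_def D_def S_def da_price_def)
  have L1: "L \<ge> 1" and n1: "n \<ge> 1"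
    using g l card_gt_0_iff[of "loads M"] card_gt_0_iff[of "gens M"] by (simp_all add: L_def n_def)
  have "q i = r * S - D" if "i \<in> loads M" for i
    using load_first_order[OF l(1) that S, of q] eq that
    by (simp add: nash_equilibrium_def r_def S_def D_def)
  then have "(\<Sum>i\<in>loads M. q i) = (\<Sum>i\<in>loads M. r * S - D)"
    by (rule sum.cong[OF refl])
  then have "D = L * (r * S - D)"
    unfolding sum_constant L_def by (simp only: D_def da_demand_def)
  \<comment> \<open>The slopes cancel: the loads alone fix the price at the fraction L/(L+1) of
    \<open>r\<close>.\<close>
  then have "S * (p * (L + 1)) = S * (L * r)" by (simp add: D_eq algebra_simps)
  then have p_eq: "p * (L + 1) = L * r" using S0 by simp
  then have p: "p = L * r / (L + 1)" using L1 by (simp add: field_simps)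
  have p0: "p > 0" and pr: "p < r" using L1 r0 by (simp_all add: p field_simps)
  have "da_demand M q \<noteq> 0" using D_eq S0 p0 by (simp add: D_def)
  then have "S * (p - r) = \<theta> j * (2 * p - r)" if "j \<in> gens M" for j
    using gen_first_order[OF g(1) that S, of q] eq that
    by (simp add: nash_equilibrium_def r_def S_def p_def)
  then have "(\<Sum>j\<in>gens M. S * (p - r)) = (\<Sum>j\<in>gens M. \<theta> j * (2 * p - r))"
    by (rule sum.cong[OF refl])
  then have "S * (n * (p - r)) = S * (2 * p - r)"
    by (simp add: total_slope_def S_def n_def flip: sum_distrib_right)
  then have "n * (p - r) = 2 * p - r" using S0 by simp
  then have "(n - 1) * (p - r) = p" by (simp add: algebra_simps)
  moreover have "(n - 1) * (p - r) \<le> 0" using n1 pr by (simp add: mult_nonneg_nonpos)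
  ultimately show False using p0 by simp
qed

lemma no_equilibrium_slope_zero_demand_zero:
  assumes l: "finite (loads M)" "loads M \<noteq> {}"
    and r: "rt_price M > 0" and S: "total_slope M \<theta> = 0" and D: "da_demand M q = 0"
  shows "\<not> nash_equilibrium M \<theta> q"
proof
  assume eq: "nash_equilibrium M \<theta> q"
  obtain i where i: "i \<in> loads M" using l by blast
  \<comment> \<open>The price drops from the real-time price to 0, and the load receives its even
    share of the one unit now demanded for free.\<close>
  have "load_payment M \<theta> q i \<le> load_payment M \<theta> (q(i := q i + 1)) i"
    using eq i by (simp add: nash_equilibrium_def)
  then have "rt_price M / real (card (loads M)) \<le> 0"
    using S D da_demand_upd[OF l(1) i]
    by (simp add: load_payment_eq da_price_def da_alloc_def no_clearing_price_def)
  moreover have "rt_price M / real (card (loads M)) > 0"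
    using r l by (simp add: card_gt_0_iff)
  ultimately show False by simp
qed

lemma no_equilibrium_slope_zero_demand_nonzero:
  assumes g: "finite (gens M)" "gens M \<noteq> {}"
    and r: "rt_price M > 0" and S: "total_slope M \<theta> = 0" and D: "da_demand M q \<noteq> 0"
  shows "\<not> nash_equilibrium M \<theta> q"
proof
  assume eq: "nash_equilibrium M \<theta> q"
  define D where "D = da_demand M q"
  \<comment> \<open>Slopes summing to zero cannot all be negative.\<close>
  obtain j where j: "j \<in> gens M" and nonneg: "\<theta> j \<ge> 0"
  proof (rule ccontr)
    assume "\<not> thesis"
    then have "\<And>j. j \<in> gens M \<Longrightarrow> \<theta> j < 0" using that by force
    then have "(\<Sum>j\<in>gens M. \<theta> j) < 0"
      using g sum_strict_mono[of "gens M" \<theta> "\<lambda>_. 0"] by auto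
    then show False using S by (simp add: total_slope_def)
  qed
  \<comment> \<open>The target price lies outside the interval from 0 to the real-time price and has
    the sign of \<open>D\<close>, so the slope increment \<open>D / p\<close> is positive.\<close>
  define p where "p = (if D > 0 then 2 * rt_price M else - rt_price M)"
  \<comment> \<open>As the old slopes sum to 0, the new total slope is \<open>D / p\<close>, which
    clears at price \<open>p\<close>.\<close>
  define x where "x = \<theta> j + D / p"
  have D0: "D \<noteq> 0" using D by (simp add: D_def)
  have slope: "D / p > 0"
    using r D0 by (auto simp: p_def zero_less_divide_iff divide_less_0_iff)
  have "p * (p - rt_price M) > 0"
    using r by (auto simp: p_def mult_neg_neg)
  moreover have "x > 0" using slope nonneg by (simp add: x_def)
  ultimately have "x * (p * (p - rt_price M)) > 0" by simp
  moreover have "da_price M (\<theta>(j := x)) q = p"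
    using slope S total_slope_upd[OF g(1) j] by (auto simp: da_price_def x_def D_def)
  moreover have "gen_profit M (\<theta>(j := x)) q j \<le> gen_profit M \<theta> q j"
    using eq j by (simp add: nash_equilibrium_def)
  moreover have "da_price M \<theta> q = 0" using S D by (simp add: da_price_def)
  ultimately show False by (simp add: gen_profit_eq)
qed

theorem theorem4:
  fixes M :: "('g, 'l) market"
  assumes "finite (gens M)" and "gens M \<noteq> {}"
    and "finite (loads M)" and "loads M \<noteq> {}"
    and "\<And>j. j \<in> gens M \<Longrightarrow> cost M j > 0"
    and "\<And>j. j \<in> gens M \<Longrightarrow> err M j \<ge> 0"
    and "total_demand M > 0"
  shows "\<not> (\<exists>\<theta> q. nash_equilibrium M \<theta> q)"
proof -
  have "rt_price M > 0" using assms by (intro rt_price_pos)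
  then have "\<not> nash_equilibrium M \<theta> q" for \<theta> q
    using no_equilibrium_slope_nonzero[OF assms(1-4), of \<theta> q]
      no_equilibrium_slope_zero_demand_zero[OF assms(3,4), of \<theta> q]
      no_equilibrium_slope_zero_demand_nonzero[OF assms(1,2), of \<theta> q]
    by blast
  then show ?thesis by blast
qed

end
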